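(* Let $\Gamma$ be a finite simplicial graph with associated right-angled Artin group $A(\Gamma)$. Given $g \in A(\Gamma)$ and an integer $n > 0$, let $w$ be a cyclically reduced word in the generators of $A(\Gamma)$ (and their inverses) representing the conjugacy class of the element $g^n$ in $A(\Gamma)$, and suppose $u$ is a word such that both $u$ and $u^{-1}$ appear as subwords of $w$, considered as a cyclic word. Then $$|u| \ \le \ \frac{|w|}{2n}.$$
   Context: The right-angled Artin group of a finite simplicial graph $\Gamma$ (no loops, no multiple edges) is $A(\Gamma) = \langle\, a \in V(\Gamma) \mid [a,b]=1 \text{ if } (a,b) \in E(\Gamma)\,\rangle$; its generators are the vertices of $\Gamma$. Words are finite sequences of letters $a^{\pm 1}$ with $a \in V(\Gamma)$; $|w|$ denotes the number of letters of $w$, and $u^{-1}$ is the formal inverse word (letters inverted, order reversed). A subword of $w$ considered as a cyclic word is a string of consecutive letters of some cyclic permutation of $w$. A word $w$ is cyclically reduced (in the sense of the right-angled Artin group $A(\Gamma)$) if it has minimal length among all words representing elements of the conjugacy class in $A(\Gamma)$ of the element represented by $w$. *)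

theory Defs
  imports
    Complex_Main
    "HOL-Library.Sublist"
    "HOL-Algebra.Group"
    "Graph_Theory.Pair_Digraph"
begin

section \<open>Words and presented groups\<close>

text \<open>The letter \<open>(a, True)\<close> stands for the generator \<open>a\<close>, and \<open>(a, False)\<close> for \<open>a\<close> inverse.
  Words are not assumed to be freely reduced.\<close>

type_synonym 'a letter = "'a \<times> bool"

definition words :: "'a set \<Rightarrow> 'a letter list set" where
  "words X = lists (X \<times> UNIV)"

definition inv_word :: "'a letter list \<Rightarrow> 'a letter list" where
  "inv_word w = rev (map (\<lambda>(a, e). (a, \<not> e)) w)"

definition cyclic_subword :: "'a list \<Rightarrow> 'a list \<Rightarrow> bool" where
  "cyclic_subword u w \<longleftrightarrow> (\<exists>k. sublist u (rotate k w))"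

text \<open>The congruence on words over \<open>X\<close> whose classes are the elements of the group with
  generators \<open>X\<close> and relators \<open>R\<close>.\<close>

inductive pres_eq :: "'a set \<Rightarrow> 'a letter list set \<Rightarrow> 'a letter list \<Rightarrow> 'a letter list \<Rightarrow> bool"
  for X R where
  refl: "w \<in> words X \<Longrightarrow> pres_eq X R w w"
| sym: "pres_eq X R v w \<Longrightarrow> pres_eq X R w v"
| trans: "pres_eq X R u v \<Longrightarrow> pres_eq X R v w \<Longrightarrow> pres_eq X R u w"
| cancel: "u \<in> words X \<Longrightarrow> v \<in> words X \<Longrightarrow> a \<in> X \<Longrightarrow>
    pres_eq X R (u @ [(a, e), (a, \<not> e)] @ v) (u @ v)"
| relator: "u \<in> words X \<Longrightarrow> v \<in> words X \<Longrightarrow> r \<in> R \<Longrightarrow> r \<in> words X \<Longrightarrow>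
    pres_eq X R (u @ r @ v) (u @ v)"

definition pres_rel :: "'a set \<Rightarrow> 'a letter list set \<Rightarrow> 'a letter list rel" where
  "pres_rel X R = {(v, w). pres_eq X R v w}"

definition presented_group :: "'a set \<Rightarrow> 'a letter list set \<Rightarrow> 'a letter list set monoid" where
  "presented_group X R =
    \<lparr> carrier = words X // pres_rel X R,
      monoid.mult = (\<lambda>A B. \<Union>v\<in>A. \<Union>w\<in>B. pres_rel X R `` {v @ w}),
      one = pres_rel X R `` {[]} \<rparr>"

lemma words_Nil [simp]: "[] \<in> words X"
  by (simp add: words_def)

lemma words_append [simp]: "v @ w \<in> words X \<longleftrightarrow> v \<in> words X \<and> w \<in> words X"
  by (auto simp: words_def)

lemma words_Cons [simp]: "(a, e) # w \<in> words X \<longleftrightarrow> a \<in> X \<and> w \<in> words X"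
  by (auto simp: words_def)

lemma words_inv_word [simp]: "inv_word w \<in> words X \<longleftrightarrow> w \<in> words X"
  by (induction w) (auto simp: inv_word_def)

lemma pres_eq_words: "pres_eq X R v w \<Longrightarrow> v \<in> words X \<and> w \<in> words X"
  by (induction rule: pres_eq.induct) auto

lemma equiv_pres_rel: "equiv (words X) (pres_rel X R)"
  by (rule equivI)
     (auto simp: pres_rel_def refl_on_def sym_def trans_def
           intro: pres_eq.intros dest: pres_eq_words)

lemma pres_eq_context:
  assumes "pres_eq X R v w" "p \<in> words X" "q \<in> words X"
  shows "pres_eq X R (p @ v @ q) (p @ w @ q)"
  using assms
proof (induction rule: pres_eq.induct)
  case (cancel u v a e)
  then show ?case using pres_eq.cancel[of "p @ u" X "v @ q" a R e] by simp
next
  case (relator u v r)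
  then show ?case using pres_eq.relator[of "p @ u" X "v @ q" r R] by simp
qed (auto intro: pres_eq.intros)

lemma pres_eq_append:
  assumes "pres_eq X R v v'" "pres_eq X R w w'"
  shows "pres_eq X R (v @ w) (v' @ w')"
  using pres_eq_context[OF assms(1), of "[]" w] pres_eq_context[OF assms(2), of v' "[]"]
    pres_eq_words[OF assms(1)] pres_eq_words[OF assms(2)]
  by (auto intro: pres_eq.trans)

lemma mult_presented_group:
  assumes "v \<in> words X" "w \<in> words X"
  shows "(pres_rel X R `` {v}) \<otimes>\<^bsub>presented_group X R\<^esub> (pres_rel X R `` {w})
    = pres_rel X R `` {v @ w}"
proof -
  let ?c = "\<lambda>w. pres_rel X R `` {w}"
  have eq: "?c (v' @ w') = ?c (v @ w)" if "v' \<in> ?c v" "w' \<in> ?c w" for v' w'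
  proof (rule equiv_class_eq[OF equiv_pres_rel, symmetric])
    show "(v @ w, v' @ w') \<in> pres_rel X R"
      using that pres_eq_append[of X R v v' w w'] by (simp add: pres_rel_def)
  qed
  have "v \<in> ?c v" "w \<in> ?c w"
    using assms by (auto simp: pres_rel_def intro: pres_eq.refl)
  then have "(\<Union>v'\<in>?c v. \<Union>w'\<in>?c w. ?c (v' @ w')) = (\<Union>v'\<in>?c v. \<Union>w'\<in>?c w. ?c (v @ w))"
    by (intro SUP_cong HOL.refl eq)
  also have "\<dots> = ?c (v @ w)"
    using \<open>v \<in> ?c v\<close> \<open>w \<in> ?c w\<close> by blast
  finally have "(\<Union>v'\<in>?c v. \<Union>w'\<in>?c w. ?c (v' @ w')) = ?c (v @ w)" .
  then show ?thesis
    by (simp add: presented_group_def)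
qed

lemma inv_word_cancel: "w \<in> words X \<Longrightarrow> pres_eq X R (inv_word w @ w) []"
proof (induction w)
  case Nil
  then show ?case by (auto simp: inv_word_def intro: pres_eq.refl)
next
  case (Cons x w)
  obtain a e where x: "x = (a, e)" by force
  have "pres_eq X R (inv_word w @ [(a, \<not> e), (a, \<not> \<not> e)] @ w) (inv_word w @ w)"
    using Cons.prems x by (intro pres_eq.cancel) auto
  then show ?case
    using Cons x by (auto simp: inv_word_def intro: pres_eq.trans)
qed

lemma group_presented_group: "group (presented_group X R)"
proof (rule groupI)
  let ?G = "presented_group X R" and ?c = "\<lambda>w. pres_rel X R `` {w}"
  have car: "\<exists>w\<in>words X. A = ?c w" if "A \<in> carrier ?G" for A
    using that by (auto simp: presented_group_def elim: quotientE)
  have car': "?c w \<in> carrier ?G" if "w \<in> words X" for w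
    using that by (auto simp: presented_group_def intro: quotientI)
  have one: "\<one>\<^bsub>?G\<^esub> = ?c []" by (simp add: presented_group_def)
  show "\<one>\<^bsub>?G\<^esub> \<in> carrier ?G" by (simp add: one car')
  show "A \<otimes>\<^bsub>?G\<^esub> B \<in> carrier ?G" if "A \<in> carrier ?G" "B \<in> carrier ?G" for A B
    using car[OF that(1)] car[OF that(2)] by (auto simp: mult_presented_group car')
  show "A \<otimes>\<^bsub>?G\<^esub> B \<otimes>\<^bsub>?G\<^esub> C = A \<otimes>\<^bsub>?G\<^esub> (B \<otimes>\<^bsub>?G\<^esub> C)"
    if "A \<in> carrier ?G" "B \<in> carrier ?G" "C \<in> carrier ?G" for A B C
    using car[OF that(1)] car[OF that(2)] car[OF that(3)] by (auto simp: mult_presented_group)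
  show "\<one>\<^bsub>?G\<^esub> \<otimes>\<^bsub>?G\<^esub> A = A" if "A \<in> carrier ?G" for A
    using car[OF that] by (auto simp: one mult_presented_group)
  show "\<exists>B\<in>carrier ?G. B \<otimes>\<^bsub>?G\<^esub> A = \<one>\<^bsub>?G\<^esub>" if A: "A \<in> carrier ?G" for A
  proof -
    obtain w where w: "w \<in> words X" "A = ?c w" using car[OF A] by blast
    have "?c (inv_word w @ w) = ?c []"
      using inv_word_cancel[OF w(1)] by (intro equiv_class_eq[OF equiv_pres_rel])
        (simp add: pres_rel_def)
    then show ?thesis
      using w by (intro bexI[of _ "?c (inv_word w)"]) (auto simp: mult_presented_group one car')
  qed
qed

definition conjugacy_class :: "('g, 'm) monoid_scheme \<Rightarrow> 'g \<Rightarrow> 'g set" where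
  "conjugacy_class G g = {x \<otimes>\<^bsub>G\<^esub> g \<otimes>\<^bsub>G\<^esub> inv\<^bsub>G\<^esub> x | x. x \<in> carrier G}"


section \<open>Right-angled Artin groups\<close>

definition commutator_word :: "'a \<Rightarrow> 'a \<Rightarrow> 'a letter list" where
  "commutator_word a b = [(a, True), (b, True), (a, False), (b, False)]"

definition raag_relators :: "'a pair_pre_digraph \<Rightarrow> 'a letter list set" where
  "raag_relators \<Gamma> = {commutator_word a b | a b. (a, b) \<in> parcs \<Gamma>}"

definition raag :: "'a pair_pre_digraph \<Rightarrow> 'a letter list set monoid" where
  "raag \<Gamma> = presented_group (pverts \<Gamma>) (raag_relators \<Gamma>)"

definition raag_elem :: "'a pair_pre_digraph \<Rightarrow> 'a letter list \<Rightarrow> 'a letter list set" where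
  "raag_elem \<Gamma> w = pres_rel (pverts \<Gamma>) (raag_relators \<Gamma>) `` {w}"

lemma group_raag: "group (raag \<Gamma>)"
  unfolding raag_def by (rule group_presented_group)

definition cyclically_reduced :: "'a pair_pre_digraph \<Rightarrow> 'a letter list \<Rightarrow> bool" where
  "cyclically_reduced \<Gamma> w \<longleftrightarrow> w \<in> words (pverts \<Gamma>) \<and>
    (\<forall>v \<in> words (pverts \<Gamma>).
      raag_elem \<Gamma> v \<in> conjugacy_class (raag \<Gamma>) (raag_elem \<Gamma> w) \<longrightarrow> length w \<le> length v)"

end

theory Submission
  imports Defs
begin

text \<open>The proof has an algebraic half, which replaces \<open>w\<close> by a periodic word, and a combinatorial
  half, which studies mirrored intervals in such a word.

  Call a word reduced if no two mutually inverse letters can be brought together by swapping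
  adjacent commuting letters, and record a word up to such swaps by its projections to all pairs of
  generators that do not commute. Reduced words for the same group element have equal projections
  (\<open>reduced_pres_eq_imp_proj_eq\<close>): the letters act on the projections of reduced
  words, the action respects the relations, and the projections of a reduced word can be
  read off from what it does to the empty word. After a conjugation \<open>w\<close> represents \<open>h\<^sup>n\<close>. Choose a shortest word
  \<open>y v y\<inverse>\<close> for \<open>h\<close> in which \<open>v\<close> is trimmed, meaning that no letter can be moved to the front of
  \<open>v\<close> while its inverse can be moved to the end. Then \<open>y v\<^sup>n y\<inverse>\<close> is reduced as well, so it has the
  projections of \<open>w\<close>, and the minimality of \<open>w\<close> forces \<open>y\<close> to be empty. Hence \<open>w\<close> and \<open>v\<^sup>n\<close> have
  equal projections, and \<open>|w| = n |v|\<close> (\<open>minimal_word_of_power_is_periodic\<close>).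

  Let \<open>W\<close> and \<open>V\<close> be the bi-infinite words with periods \<open>w\<close> and \<open>v\<close>. Sending the \<open>t\<close>-th
  occurrence of a generator in \<open>W\<close> to its \<open>t\<close>-th occurrence in \<open>V\<close> is a bijection \<open>\<theta>\<close> between
  positions that preserves letters and the relative order of letters that do not commute. The
  translations of \<open>V\<close> by multiples of \<open>|v|\<close> pull back along \<open>\<theta>\<close> to permutations \<open>\<sigma>\<close> of the positions
  of \<open>W\<close> with the same two properties, and these have \<open>|v|\<close> orbits. Occurrences of \<open>u\<close> and \<open>u\<inverse>\<close> are
  two intervals \<open>U\<close> and \<open>U'\<close> of positions of \<open>W\<close> that are exchanged by a reflection, which
  inverts letters. The main point is that no \<open>\<sigma>\<close> maps a position of \<open>U'\<close> into \<open>U\<close>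
  (\<open>shift_mirror_disjoint\<close>): otherwise the reflection followed by \<open>\<sigma>\<close> exchanges two
  positions of \<open>U\<close> that carry mutually inverse letters. Since \<open>W\<close> is reduced, a letter that does
  not commute with these lies between them; its image lies between them too, so that a closer pair is
  exchanged, and the descent cannot go on for ever. Therefore \<open>U\<close> and \<open>U'\<close> meet disjoint sets of
  orbits. Neither meets an orbit twice, because it would then meet all orbits that belong to the
  same generator, among them orbits met by the other interval. Counting orbits gives \<open>2 |u| \<le> |v|\<close>.\<close>

section \<open>Words, formal inverses and powers\<close>

definition inv_letter :: "'a letter \<Rightarrow> 'a letter" where
  "inv_letter x = (fst x, \<not> snd x)"

lemma fst_inv_letter [simp]: "fst (inv_letter x) = fst x"
  by (simp add: inv_letter_def)

lemma inv_letter_inv_letter [simp]: "inv_letter (inv_letter x) = x"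
  by (simp add: inv_letter_def)

lemma inv_letter_neq [simp]: "inv_letter x \<noteq> x" "x \<noteq> inv_letter x"
  by (cases x; simp add: inv_letter_def)+

lemma inv_word_Nil [simp]: "inv_word [] = []"
  by (simp add: inv_word_def)

lemma inv_word_Cons [simp]: "inv_word (x # w) = inv_word w @ [inv_letter x]"
  by (simp add: inv_word_def inv_letter_def split: prod.split)

lemma inv_word_append [simp]: "inv_word (v @ w) = inv_word w @ inv_word v"
  by (simp add: inv_word_def)

lemma inv_word_inv_word [simp]: "inv_word (inv_word w) = w"
  by (induction w) auto

lemma length_inv_word [simp]: "length (inv_word w) = length w"
  by (simp add: inv_word_def)

lemma nth_inv_word: "i < length w \<Longrightarrow> inv_word w ! i = inv_letter (w ! (length w - Suc i))"
  by (simp add: inv_word_def rev_nth inv_letter_def split: prod.split)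

definition word_power :: "'b list \<Rightarrow> nat \<Rightarrow> 'b list" where
  "word_power w n = concat (replicate n w)"

lemma word_power_0 [simp]: "word_power w 0 = []"
  by (simp add: word_power_def)

lemma word_power_Suc [simp]: "word_power w (Suc n) = w @ word_power w n"
  by (simp add: word_power_def)

lemma word_power_Suc_right: "word_power w (Suc n) = word_power w n @ w"
  by (induction n) auto

lemma length_word_power [simp]: "length (word_power w n) = n * length w"
  by (induction n) auto

lemma nth_word_power: "i < n * length w \<Longrightarrow> word_power w n ! i = w ! (i mod length w)"
proof (induction n arbitrary: i)
  case (Suc n)
  then show ?case
    by (cases "i < length w") (auto simp: nth_append le_mod_geq)
qed simp

lemma words_Cons' [simp]: "x # w \<in> words X \<longleftrightarrow> fst x \<in> X \<and> w \<in> words X"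
  by (cases x) simp

lemma words_word_power: "w \<in> words X \<Longrightarrow> word_power w n \<in> words X"
  by (induction n) auto

text \<open>Positions of a bi-infinite word of period \<open>L\<close> are integers; this copies a permutation \<open>f\<close> of one
  period \<open>{..<L}\<close> into every block \<open>{L * k..<L * (k + 1)}\<close>.\<close>

definition periodic_extension :: "int \<Rightarrow> (nat \<Rightarrow> nat) \<Rightarrow> int \<Rightarrow> int" where
  "periodic_extension L f i = L * (i div L) + int (f (nat (i mod L)))"

lemma periodic_extension_div_mod:
  assumes "L > 0" "f ` {..<nat L} \<subseteq> {..<nat L}"
  shows "periodic_extension L f i div L = i div L"
    and "periodic_extension L f i mod L = int (f (nat (i mod L)))"
proof -
  have "nat (i mod L) < nat L" using assms(1) by simp
  then have "f (nat (i mod L)) < nat L" using assms(2) by (simp add: image_subset_iff)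
  then have *: "0 \<le> int (f (nat (i mod L)))" "int (f (nat (i mod L))) < L" by auto
  then show "periodic_extension L f i div L = i div L"
    and "periodic_extension L f i mod L = int (f (nat (i mod L)))"
    using assms(1) by (simp_all add: periodic_extension_def div_pos_pos_trivial)
qed

lemma bij_periodic_extension:
  assumes L: "L > 0" and f: "bij_betw f {..<nat L} {..<nat L}"
  shows "bij (periodic_extension L f)"
proof -
  have inverse: "periodic_extension L g (periodic_extension L f i) = i"
    if "f ` {..<nat L} \<subseteq> {..<nat L}" "\<And>k. k \<in> {..<nat L} \<Longrightarrow> g (f k) = k" for f g i
  proof -
    have "nat (i mod L) \<in> {..<nat L}" using L by simp
    then show ?thesis using L that(2)
      by (simp add: periodic_extension_def[of L g] periodic_extension_div_mod[OF L that(1)])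
  qed
  let ?g = "inv_into {..<nat L} f"
  have g: "bij_betw ?g {..<nat L} {..<nat L}" using f by (rule bij_betw_inv_into)
  show ?thesis
  proof (rule o_bij)
    show "periodic_extension L ?g \<circ> periodic_extension L f = id"
    proof
      fix i show "(periodic_extension L ?g \<circ> periodic_extension L f) i = id i"
        using inverse[of f ?g i] f by (simp add: bij_betw_def)
    qed
    show "periodic_extension L f \<circ> periodic_extension L ?g = id"
    proof
      fix i show "(periodic_extension L f \<circ> periodic_extension L ?g) i = id i"
        using inverse[of ?g f i] f g by (simp add: bij_betw_def f_inv_into_f)
    qed
  qed
qed

lemma cyclic_subword_imp_nth:
  assumes "cyclic_subword u w"
  obtains p where "\<And>t. t < length u \<Longrightarrow> u ! t = w ! ((p + t) mod length w)"
proof -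
  from assms obtain k xs ys where r: "rotate k w = xs @ u @ ys"
    by (auto simp: cyclic_subword_def sublist_def)
  then have len: "length w = length xs + length u + length ys"
    by (metis length_append length_rotate add.assoc)
  show ?thesis
  proof (rule that[of "k + length xs"])
    fix t assume t: "t < length u"
    have "u ! t = rotate k w ! (length xs + t)" using t by (simp add: r nth_append)
    then show "u ! t = w ! ((k + length xs + t) mod length w)"
      using t len by (simp add: nth_rotate add.assoc)
  qed
qed

section \<open>Computing in a presented group with representatives\<close>

declare pres_eq.trans [trans]

lemma pres_eq_cancel_letters:
  assumes "u \<in> words X" "v \<in> words X" "fst x \<in> X"
  shows "pres_eq X R (u @ [x, inv_letter x] @ v) (u @ v)"
  using pres_eq.cancel[OF assms, of R "snd x"] by (simp add: inv_letter_def)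

lemma pres_eq_inv_word_cancel: 
  assumes "y \<in> words X" "w \<in> words X" 
  shows "pres_eq X R (inv_word y @ y @ w) w" "pres_eq X R (y @ inv_word y @ w) w"
  using pres_eq_context[OF inv_word_cancel[of y X R], of "[]" w]
     pres_eq_context[OF inv_word_cancel[of "inv_word y" X R], of "[]" w] assms
  by simp_all

lemma pres_eq_conj_power:
  assumes "y \<in> words X" "v \<in> words X"
  shows "pres_eq X R (word_power (y @ v @ inv_word y) n) (y @ word_power v n @ inv_word y)"
proof (induction n)
  case 0
  have "pres_eq X R (inv_word (inv_word y) @ inv_word y) []"
    by (rule inv_word_cancel) (simp add: assms)
  then show ?case by (simp add: pres_eq.sym)
next
  case (Suc n)
  let ?h = "y @ v @ inv_word y"
  have vn: "word_power v n \<in> words X" by (rule words_word_power[OF assms(2)])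
  have "pres_eq X R (?h @ word_power ?h n) (?h @ (y @ word_power v n @ inv_word y))"
    using Suc assms by (intro pres_eq_append pres_eq.refl) auto
  moreover have "pres_eq X R (?h @ (y @ word_power v n @ inv_word y))
      ((y @ v) @ (word_power v n @ inv_word y))"
    using pres_eq_append[OF pres_eq.refl[of "y @ v" X R] 
        pres_eq_inv_word_cancel(1)[of y X "word_power v n @ inv_word y" R]] assms vn by simp
  ultimately show ?case by (auto intro: pres_eq.trans)
qed

lemma pres_eq_word_power:
  "pres_eq X R v w \<Longrightarrow> pres_eq X R (word_power v n) (word_power w n)"
  by (induction n) (auto intro: pres_eq.refl pres_eq_append)

lemma pres_eq_commute_inv_word:
  assumes "pres_eq X R (p @ q) (q @ p)"
  shows "pres_eq X R (inv_word p @ q) (q @ inv_word p)"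
proof -
  have w: "p \<in> words X" "q \<in> words X" using pres_eq_words[OF assms] by auto
  have "pres_eq X R (p @ inv_word p) []"
    using inv_word_cancel[of "inv_word p" X R] w by simp
  from pres_eq_context[OF this, of "inv_word p @ q" "[]"] w
  have "pres_eq X R (inv_word p @ q) (inv_word p @ q @ p @ inv_word p)"
    by (simp add: pres_eq.sym)
  also have "pres_eq X R \<dots> (inv_word p @ p @ q @ inv_word p)"
    using pres_eq_context[OF pres_eq.sym[OF assms], of "inv_word p" "inv_word p"] w by simp
  also have "pres_eq X R \<dots> (q @ inv_word p)"
    using pres_eq_inv_word_cancel(1)[of p X "q @ inv_word p" R] w by simp
  finally show ?thesis .
qed

lemma pres_class_eq_iff:
  assumes "v \<in> words X" "w \<in> words X"
  shows "pres_rel X R `` {v} = pres_rel X R `` {w} \<longleftrightarrow> pres_eq X R v w"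
  using eq_equiv_class_iff[OF equiv_pres_rel assms, of R] by (simp add: pres_rel_def)

lemma carrier_presented_group:
  "carrier (presented_group X R) = {pres_rel X R `` {w} | w. w \<in> words X}"
  by (auto simp: presented_group_def quotient_def)

lemma one_presented_group: "\<one>\<^bsub>presented_group X R\<^esub> = pres_rel X R `` {[]}"
  by (simp add: presented_group_def)

lemma inv_presented_group:
  assumes "y \<in> words X"
  shows "inv\<^bsub>presented_group X R\<^esub> (pres_rel X R `` {y}) = pres_rel X R `` {inv_word y}"
proof (rule group.inv_equality[OF group_presented_group])
  show "pres_rel X R `` {inv_word y} \<otimes>\<^bsub>presented_group X R\<^esub> pres_rel X R `` {y}
      = \<one>\<^bsub>presented_group X R\<^esub>"
    using assms inv_word_cancel[OF assms, of R]
    by (simp add: mult_presented_group one_presented_group pres_class_eq_iff)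
qed (use assms in \<open>auto simp: carrier_presented_group\<close>)

lemma pow_presented_group:
  assumes "h \<in> words X"
  shows "(pres_rel X R `` {h}) [^]\<^bsub>presented_group X R\<^esub> n = pres_rel X R `` {word_power h n}"
proof (induction n)
  case 0
  then show ?case by (simp add: one_presented_group)
next
  case (Suc n)
  then show ?case using assms
    by (simp add: mult_presented_group words_word_power word_power_Suc_right del: word_power_Suc)
qed

lemma conjugacy_class_presented_group:
  assumes "v \<in> words X" "w \<in> words X"
  shows "pres_rel X R `` {w} \<in> conjugacy_class (presented_group X R) (pres_rel X R `` {v}) \<longleftrightarrow>
    (\<exists>y\<in>words X. pres_eq X R w (y @ v @ inv_word y))"
proof -
  have "pres_rel X R `` {y} \<otimes>\<^bsub>presented_group X R\<^esub> pres_rel X R `` {v}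
      \<otimes>\<^bsub>presented_group X R\<^esub> inv\<^bsub>presented_group X R\<^esub> (pres_rel X R `` {y})
    = pres_rel X R `` {y @ v @ inv_word y}" if "y \<in> words X" for y
    using that assms by (simp add: inv_presented_group mult_presented_group)
  then have "conjugacy_class (presented_group X R) (pres_rel X R `` {v})
      = (\<lambda>y. pres_rel X R `` {y @ v @ inv_word y}) ` words X"
    unfolding conjugacy_class_def carrier_presented_group by (auto simp: image_iff)
  then show ?thesis
    using assms by (auto simp: image_iff pres_class_eq_iff)
qed

text \<open>Minimality of a word in its conjugacy class compares it with the words \<open>v\<close> such that \<open>v\<close> is a
  conjugate of \<open>w\<close>, whereas rewriting \<open>w\<close> shows that \<open>w\<close> is a conjugate of \<open>v\<close>.\<close>

lemma pres_eq_conj_swap: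
  assumes "pres_eq X R w (y @ v @ inv_word y)"
  shows "pres_eq X R v (inv_word y @ w @ inv_word (inv_word y))"
proof -
  have m: "y \<in> words X" "v \<in> words X" using pres_eq_words[OF assms] by auto
  have "pres_eq X R v (v @ inv_word y @ y)"
    using pres_eq_context[OF pres_eq.sym[OF inv_word_cancel[of y X R]], of v "[]"] m by simp
  also have "pres_eq X R \<dots> (inv_word y @ y @ (v @ inv_word y @ y))"
    using m by (intro pres_eq.sym[OF pres_eq_inv_word_cancel(1)]) auto
  also have "pres_eq X R \<dots> (inv_word y @ w @ y)"
    using pres_eq_context[OF pres_eq.sym[OF assms], of "inv_word y" y] m by simp
  finally show ?thesis by simp
qed

section \<open>Reduced words over partially commuting letters\<close>

text \<open>For a right-angled Artin group, \<open>comm\<close> is adjacency in the defining graph. A generator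
  does not count as commuting with itself, so occurrences of one generator never change places.\<close>

locale partial_commutation =
  fixes comm :: "'a \<Rightarrow> 'a \<Rightarrow> bool"
  assumes comm_sym: "comm a b \<Longrightarrow> comm b a"
    and comm_irrefl [simp]: "\<not> comm a a"
begin

text \<open>The letter \<open>x\<close> leads a word if it can be moved to the front by swapping adjacent commuting letters,
  and dually it ends a word if it can be moved to the back.\<close>

fun leads :: "'a letter \<Rightarrow> 'a letter list \<Rightarrow> bool" where
  "leads x [] \<longleftrightarrow> False"
| "leads x (y # w) \<longleftrightarrow> y = x \<or> comm (fst x) (fst y) \<and> leads x w"

definition ends :: "'a letter \<Rightarrow> 'a letter list \<Rightarrow> bool" where
  "ends x w \<longleftrightarrow> leads x (rev w)"

text \<open>Swaps never bring two mutually inverse letters together: a letter added in front cancels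
  only against an inverse that can be moved up to it.\<close>

fun reduced :: "'a letter list \<Rightarrow> bool" where
  "reduced [] \<longleftrightarrow> True"
| "reduced (x # w) \<longleftrightarrow> \<not> leads (inv_letter x) w \<and> reduced w"

text \<open>The projections to pairs of non-commuting generators (including \<open>a = b\<close>) are invariant under
  swaps of commuting letters. They serve as a substitute for the class of a word modulo swaps:
  equality of projections is an equality of functions and needs no induction over swaps.\<close>

definition proj :: "'a letter list \<Rightarrow> 'a \<Rightarrow> 'a \<Rightarrow> 'a letter list" where
  "proj w a b = (if comm a b then [] else filter (\<lambda>x. fst x = a \<or> fst x = b) w)"

lemma leads_append:
  "leads x (u @ v) \<longleftrightarrow> leads x u \<or> (\<forall>y\<in>set u. comm (fst x) (fst y)) \<and> leads x v"
  by (induction u) auto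

lemma ends_append:
  "ends x (u @ v) \<longleftrightarrow> ends x v \<or> (\<forall>y\<in>set v. comm (fst x) (fst y)) \<and> ends x u"
  by (auto simp: ends_def leads_append)

lemma ends_Nil [simp]: "\<not> ends x []"
  by (simp add: ends_def)

lemma ends_Cons: "ends x (y # w) \<longleftrightarrow> ends x w \<or> (\<forall>z\<in>set w. comm (fst x) (fst z)) \<and> y = x"
  by (auto simp: ends_def leads_append)

lemma reduced_append:
  "reduced (u @ v) \<longleftrightarrow> reduced u \<and> reduced v \<and> (\<forall>x. ends x u \<longrightarrow> \<not> leads (inv_letter x) v)"
  by (induction u) (auto simp: leads_append ends_Cons)

lemma leads_split:
  "leads x w \<Longrightarrow> \<exists>p q. w = p @ x # q \<and> (\<forall>y\<in>set p. comm (fst x) (fst y))"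
proof (induction w)
  case (Cons y w)
  show ?case
  proof (cases "y = x")
    case True then show ?thesis by (intro exI[of _ "[]"] exI[of _ w]) simp
  next
    case False
    with Cons obtain p q where "w = p @ x # q" "\<forall>y\<in>set p. comm (fst x) (fst y)" by auto
    with Cons.prems False show ?thesis by (intro exI[of _ "y # p"] exI[of _ q]) auto
  qed
qed simp

lemma ends_split:
  assumes "ends x w"
  shows "\<exists>p q. w = p @ x # q \<and> (\<forall>y\<in>set q. comm (fst x) (fst y))"
proof -
  from assms leads_split[of x "rev w"]
  obtain p q where "rev w = p @ x # q" "\<forall>y\<in>set p. comm (fst x) (fst y)"
    by (auto simp: ends_def)
  then have "w = rev q @ x # rev p" "\<forall>y\<in>set (rev p). comm (fst x) (fst y)"
    by (simp_all add: rev_swap)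
  then show ?thesis by blast
qed

lemma remove1_leads:
  assumes "leads x w"
  obtains p q where "w = p @ x # q" "remove1 x w = p @ q" "\<forall>y\<in>set p. comm (fst x) (fst y)"
proof -
  obtain p q where pq: "w = p @ x # q" "\<forall>y\<in>set p. comm (fst x) (fst y)"
    using leads_split[OF assms] by blast
  then have "x \<notin> set p" by auto
  then show ?thesis using pq by (intro that[of p q]) (simp_all add: remove1_append)
qed

lemma leads_not_comm: "leads x w \<Longrightarrow> \<exists>y\<in>set w. \<not> comm (fst x) (fst y)"
  using leads_split by fastforce

lemma proj_Cons_eq: "proj v = proj w \<longleftrightarrow> proj (x # v) = proj (x # w)"
  by (auto simp: proj_def fun_eq_iff)

lemma proj_Cons_swap: "comm (fst x) (fst y) \<Longrightarrow> proj (x # y # w) = proj (y # x # w)"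
  using comm_sym by (fastforce simp: proj_def fun_eq_iff)

text \<open>The first occurrence of a leading letter is the one that can be moved to the front.\<close>

lemma proj_leads: "leads x w \<Longrightarrow> proj w = proj (x # remove1 x w)"
proof (induction w)
  case (Cons y w)
  show ?case
  proof (cases "y = x")
    case False
    with Cons have c: "comm (fst x) (fst y)" and l: "leads x w" by auto
    then have "proj (y # w) = proj (y # x # remove1 x w)"
      using Cons.IH proj_Cons_eq by blast
    also have "\<dots> = proj (x # y # remove1 x w)"
      using proj_Cons_swap[OF c] by simp
    finally show ?thesis using False by simp
  qed simp
qed simp

section \<open>Reduced words for the same element differ by commutations\<close>

text \<open>An arbitrary family \<open>f\<close> of words takes the place of \<open>proj w\<close>. The definition reads off from the
  projections alone whether a letter leads (\<open>starts_proj\<close>), so leading depends only on the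
  projections.\<close>

definition starts :: "'a letter \<Rightarrow> ('a \<Rightarrow> 'a \<Rightarrow> 'a letter list) \<Rightarrow> bool" where
  "starts x f \<longleftrightarrow> (\<forall>b. \<not> comm (fst x) b \<longrightarrow> (\<exists>zs. f (fst x) b = x # zs))"

text \<open>If \<open>x\<close> does not lead, then either its generator does not occur at all, or the first letter that
  does not commute with \<open>x\<close> comes first in the projection to the generators of these two letters.\<close>

lemma starts_proj: "starts x (proj w) \<longleftrightarrow> leads x w"
proof (induction w)
  case Nil
  show ?case by (auto simp: starts_def proj_def intro!: exI[of _ "fst x"])
next
  case (Cons y w)
  consider "y = x" | "y \<noteq> x" "fst y = fst x" | "fst y \<noteq> fst x" "comm (fst x) (fst y)"
    | "fst y \<noteq> fst x" "\<not> comm (fst x) (fst y)" by blast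
  then show ?case
  proof cases
    case 1 then show ?thesis by (simp add: starts_def proj_def)
  next
    case 2 
    then have "\<not> starts x (proj (y # w))"
      by (auto simp: starts_def proj_def intro!: exI[of _ "fst x"])
    with 2 show ?thesis by simp
  next
    case 3 
    then have "proj (y # w) (fst x) b = proj w (fst x) b" for b by (auto simp: proj_def)
    then have "starts x (proj (y # w)) \<longleftrightarrow> starts x (proj w)" by (simp add: starts_def)
    with Cons 3 show ?thesis by auto
  next
    case 4
    then have "\<not> starts x (proj (y # w))"
      by (auto simp: starts_def proj_def intro!: exI[of _ "fst y"])
    with 4 show ?thesis by auto
  qed
qed

lemma leads_proj_cong: "proj v = proj w \<Longrightarrow> leads x v \<longleftrightarrow> leads x w"
  by (metis starts_proj)

text \<open>Moving a leading letter to the front keeps a word reduced. This is the reason why the action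
  defined below maps projections of reduced words to projections of reduced words.\<close>

lemma reduced_remove1: "reduced w \<Longrightarrow> leads x w \<Longrightarrow> reduced (x # remove1 x w)"
proof (induction w)
  case (Cons y w)
  show ?case
  proof (cases "y = x")
    case False
    with Cons have c: "comm (fst x) (fst y)" and l: "leads x w" and r: "reduced (x # remove1 x w)" 
      by auto
    have "\<not> leads (inv_letter y) (x # remove1 x w)"
      using Cons.prems(1) leads_proj_cong[OF proj_leads[OF l]] by simp
    then have "\<not> leads (inv_letter y) (remove1 x w)"
      using comm_sym[OF c] by simp
    moreover have "y \<noteq> inv_letter x" using c by auto
    ultimately show ?thesis using r False by simp
  qed (use Cons in simp)
qed simp

text \<open>Multiplication by the letter \<open>x\<close> from the left, on the level of projections: cancel against a
  leading inverse if there is one, and otherwise put \<open>x\<close> in front of all words that see its generator.\<close>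

definition step :: "'a letter \<Rightarrow> ('a \<Rightarrow> 'a \<Rightarrow> 'a letter list) \<Rightarrow> ('a \<Rightarrow> 'a \<Rightarrow> 'a letter list)" where
  "step x f = (\<lambda>a b. if comm a b \<or> fst x \<noteq> a \<and> fst x \<noteq> b then f a b
     else if starts (inv_letter x) f then tl (f a b) else x # f a b)"

lemma step_proj: "\<not> leads (inv_letter x) w \<Longrightarrow> step x (proj w) = proj (x # w)"
  by (auto simp: step_def starts_proj proj_def fun_eq_iff)

lemma step_proj_Cons: "step x (proj (inv_letter x # w)) = proj w"
proof -
  have "starts (inv_letter x) (proj (inv_letter x # w))" by (simp add: starts_proj)
  then show ?thesis by (auto simp: step_def proj_def fun_eq_iff)
qed

text \<open>If the generators of \<open>x\<close> and \<open>y\<close> commute, then no projection sees both of them, so the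
  two operations read and write disjoint parts of the family. This is the advantage of
  projections over words, where cancellations would have to be compared case by case.\<close>

lemma step_commute:
  assumes "comm (fst x) (fst y)"
  shows "step x (step y f) = step y (step x f)"
proof -
  have ne: "fst x \<noteq> fst y" using assms by auto
  have "starts (inv_letter x) (step y f) \<longleftrightarrow> starts (inv_letter x) f"
    using assms ne by (auto simp: starts_def step_def)
  moreover have "starts (inv_letter y) (step x f) \<longleftrightarrow> starts (inv_letter y) f"
    using comm_sym[OF assms] ne by (auto simp: starts_def step_def)
  ultimately show ?thesis
    using assms comm_sym[OF assms] ne 
    by (auto simp: step_def[of x "step y f"] step_def[of y "step x f"] fun_eq_iff)
       (auto simp: step_def)
qed

definition states :: "('a \<Rightarrow> 'a \<Rightarrow> 'a letter list) set" where
  "states = proj ` {w. reduced w}"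

text \<open>Cancellation of inverse letters fails on arbitrary families, where removing a leading letter may
  expose its inverse, which the next step would remove as well. In a reduced word this cannot happen.\<close>

lemma step_states:
  assumes "f \<in> states"
  shows "step x f \<in> states" "step x (step (inv_letter x) f) = f"
proof -
  obtain w where f: "f = proj w" and w: "reduced w" using assms by (auto simp: states_def)
  have *: "step y f \<in> states" for y
  proof (cases "leads (inv_letter y) w")
    case True
    then have "f = proj (inv_letter y # remove1 (inv_letter y) w)"
      using proj_leads f by simp
    moreover have "reduced (remove1 (inv_letter y) w)"
      using reduced_remove1[OF w True] by simp
    ultimately show ?thesis by (simp add: step_proj_Cons states_def)
  next
    case False
    then show ?thesis using step_proj[OF False] f w by (auto simp: states_def simp del: step_proj)
  qed
  show "step x f \<in> states" by (rule *)
  show "step x (step (inv_letter x) f) = f"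
  proof (cases "leads x w")
    case True
    let ?r = "remove1 x w"
    have r: "reduced (x # ?r)" using reduced_remove1[OF w True] .
    have fr: "f = proj (x # ?r)" using proj_leads[OF True] f by simp
    have "step (inv_letter x) f = proj ?r"
      using step_proj_Cons[of "inv_letter x" ?r] fr by simp
    then show ?thesis using step_proj[of x ?r] r fr by simp
  next
    case False
    then have "step (inv_letter x) f = proj (inv_letter x # w)"
      using step_proj[of "inv_letter x" w] f by simp
    then show ?thesis using f by (simp add: step_proj_Cons)
  qed
qed

lemma foldr_step_states: "f \<in> states \<Longrightarrow> foldr step w f \<in> states"
  by (induction w) (auto intro: step_states)

abbreviation relators :: "'a letter list set" where
  "relators \<equiv> {commutator_word a b | a b. comm a b}"

text \<open>The action respects the defining relations of the group.\<close>

lemma foldr_step_pres_eq: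
  "pres_eq X relators v w \<Longrightarrow> f \<in> states \<Longrightarrow> foldr step v f = foldr step w f"
proof (induction arbitrary: f rule: pres_eq.induct)
  case (cancel u v a e)
  then show ?case
    using step_states(2)[OF foldr_step_states[OF cancel.prems], of "(a, e)" v]
    by (simp add: inv_letter_def)
next
  case (relator u v r)
  then obtain a b where r: "r = commutator_word a b" and c: "comm a b" by auto
  let ?g = "foldr step v f"
  have g: "?g \<in> states" using foldr_step_states relator.prems .
  have "foldr step r ?g = step (a, True) (step (b, True) (step (a, False) (step (b, False) ?g)))"
    by (simp add: r commutator_word_def)
  also have "step (a, False) (step (b, False) ?g) = step (b, False) (step (a, False) ?g)"
    by (rule step_commute) (simp add: c)
  also have "step (b, True) (step (b, False) (step (a, False) ?g)) = step (a, False) ?g"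
    using step_states(2)[of "step (a, False) ?g" "(b, True)"] step_states(1)[OF g]
    by (simp add: inv_letter_def)
  also have "step (a, True) (step (a, False) ?g) = ?g"
    using step_states(2)[OF g, of "(a, True)"] by (simp add: inv_letter_def)
  finally show ?case by simp
qed auto

lemma foldr_step_reduced: "reduced w \<Longrightarrow> foldr step w (proj []) = proj w"
  by (induction w) (auto simp: step_proj)

text \<open>Apply both words to the empty word: acting with a reduced word never cancels, so the result
  is its own projection, while equal group elements act equally.\<close>

lemma reduced_pres_eq_imp_proj_eq:
  assumes "pres_eq X relators v w" "reduced v" "reduced w"
  shows "proj v = proj w"
proof -
  have "proj [] \<in> states" by (auto simp: states_def intro!: image_eqI[of _ _ "[]"])
  from foldr_step_pres_eq[OF assms(1) this] show ?thesis
    using assms by (simp add: foldr_step_reduced)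
qed

section \<open>Matching occurrences in words with equal projections\<close>

lemma proj_Nil_iff: "proj [] = proj w \<longleftrightarrow> w = []"
proof
  assume "proj [] = proj w"
  then have "\<not> leads x w" for x using leads_proj_cong[of "[]" w x] by simp
  then show "w = []" by (cases w) auto
qed simp

text \<open>The \<open>t\<close>-th occurrence of each generator in \<open>v\<close> is matched with its \<open>t\<close>-th occurrence in \<open>w\<close>. By
  induction on \<open>v\<close>: its first letter \<open>x\<close> leads \<open>w\<close>, say \<open>w = p @ x # q\<close> with \<open>p\<close> commuting with \<open>x\<close>, and
  the rest of \<open>v\<close> is matched with \<open>p @ q\<close>.\<close>

lemma proj_eq_imp_matching:
  assumes "proj v = proj w"
  shows "length v = length w \<and> (\<exists>\<theta>. bij_betw \<theta> {..<length v} {..<length w} \<and>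
    (\<forall>i<length v. w ! \<theta> i = v ! i) \<and>
    (\<forall>i j. i < j \<longrightarrow> j < length v \<longrightarrow> \<not> comm (fst (v ! i)) (fst (v ! j)) \<longrightarrow> \<theta> i < \<theta> j))"
  using assms
proof (induction v arbitrary: w)
  case Nil
  then show ?case using proj_Nil_iff by (simp add: bij_betw_def)
next
  case (Cons x v)
  have l: "leads x w" using leads_proj_cong[OF Cons.prems, of x] by simp
  obtain p q where pq: "w = p @ x # q" "remove1 x w = p @ q" "\<forall>y\<in>set p. comm (fst x) (fst y)"
    using remove1_leads[OF l] .
  have "proj v = proj (p @ q)"
    using Cons.prems proj_leads[OF l] pq proj_Cons_eq by metis
  from Cons.IH[OF this] obtain \<theta> where len: "length v = length (p @ q)"
    and bij: "bij_betw \<theta> {..<length v} {..<length (p @ q)}"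
    and eq: "\<And>i. i < length v \<Longrightarrow> (p @ q) ! \<theta> i = v ! i"
    and mono: "\<And>i j. \<lbrakk>i < j; j < length v; \<not> comm (fst (v ! i)) (fst (v ! j))\<rbrakk> \<Longrightarrow> \<theta> i < \<theta> j"
    by blast
  \<comment> \<open>The embedding of the positions of \<open>p @ q\<close> into those of \<open>p @ x # q\<close>, which skips \<open>x\<close>.\<close>
  define sk where "sk i = (if i < length p then i else Suc i)" for i
  define \<theta>' where "\<theta>' i = (case i of 0 \<Rightarrow> length p | Suc i \<Rightarrow> sk (\<theta> i))" for i
  have sk_nth: "w ! sk i = (p @ q) ! i" for i
    by (auto simp: sk_def pq nth_append Suc_diff_le)
  have sk_mono: "i < j \<Longrightarrow> sk i < sk j" for i j by (auto simp: sk_def)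
  have sk_ne: "sk i \<noteq> length p" for i by (auto simp: sk_def)
  have \<theta>_less: "\<theta> i < length (p @ q)" if "i < length v" for i
    using bij that by (auto simp: bij_betw_def)
  have lenw: "length (x # v) = length w" using len pq by simp
  have "inj_on \<theta>' {..<length (x # v)}"
  proof (rule inj_onI)
    fix i j assume ij: "i \<in> {..<length (x # v)}" "j \<in> {..<length (x # v)}" "\<theta>' i = \<theta>' j"
    have inj_sk: "sk a = sk b \<Longrightarrow> a = b" for a b by (auto simp: sk_def split: if_splits)
    show "i = j" 
      using ij sk_ne sk_ne[symmetric] bij
      by (auto simp: \<theta>'_def bij_betw_def split: nat.splits dest!: inj_sk dest: inj_onD)
  qed
  moreover have sub: "\<theta>' ` {..<length (x # v)} \<subseteq> {..<length w}"
    using \<theta>_less by (auto simp: \<theta>'_def pq sk_def split: nat.splits)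
  ultimately have "bij_betw \<theta>' {..<length (x # v)} {..<length w}"
    unfolding bij_betw_def using lenw
    by (metis card_image card_lessThan card_subset_eq finite_lessThan)
  moreover have "w ! \<theta>' i = (x # v) ! i" if "i < length (x # v)" for i
    using that eq by (cases i) (auto simp: \<theta>'_def sk_nth, simp add: pq)
  moreover have "\<theta>' i < \<theta>' j"
    if ij: "i < j" "j < length (x # v)" "\<not> comm (fst ((x # v) ! i)) (fst ((x # v) ! j))" for i j
  proof -
    obtain j' where j: "j = Suc j'" using ij by (cases j) auto
    show ?thesis
    proof (cases i)
      case 0
      \<comment> \<open>The letter matched with \<open>v ! j'\<close> does not commute with \<open>x\<close>, so it is not in \<open>p\<close>.\<close>
      have "\<not> \<theta> j' < length p"
      proof
        assume "\<theta> j' < length p"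
        then have "v ! j' \<in> set p" using eq[of j'] ij j by (simp add: nth_append flip: eq)
        with pq ij 0 j show False by simp
      qed
      then show ?thesis by (simp add: \<theta>'_def j 0 sk_def)
    next
      case (Suc i')
      then show ?thesis using mono[of i' j'] ij j by (simp add: \<theta>'_def sk_mono)
    qed
  qed
  ultimately show ?case using lenw by blast
qed

lemma leads_nth:
  "leads x w \<longleftrightarrow> (\<exists>j<length w. w ! j = x \<and> (\<forall>s<j. comm (fst x) (fst (w ! s))))"
proof (induction w)
  case (Cons y w)
  show ?case
  proof
    assume "leads x (y # w)"
    then consider "y = x" | "comm (fst x) (fst y)" "leads x w" by auto
    then show "\<exists>j<length (y # w). (y # w) ! j = x \<and> (\<forall>s<j. comm (fst x) (fst ((y # w) ! s)))"
    proof cases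
      case 2
      then obtain j where "j < length w" "w ! j = x" "\<forall>s<j. comm (fst x) (fst (w ! s))"
        using Cons by blast
      then show ?thesis using 2 by (intro exI[of _ "Suc j"]) (auto simp: less_Suc_eq_0_disj)
    qed auto
  next
    assume "\<exists>j<length (y # w). (y # w) ! j = x \<and> (\<forall>s<j. comm (fst x) (fst ((y # w) ! s)))"
    then obtain j where j: "j < length (y # w)" "(y # w) ! j = x"
        "\<forall>s<j. comm (fst x) (fst ((y # w) ! s))" by blast
    show "leads x (y # w)"
    proof (cases j)
      case (Suc j')
      have "\<forall>s<j'. comm (fst x) (fst (w ! s))" using j Suc by (metis Suc_mono nth_Cons_Suc)
      then have "leads x w" using Cons j Suc by auto
      moreover have "comm (fst x) (fst y)" using j Suc by auto
      ultimately show ?thesis by simp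
    qed (use j in simp)
  qed
qed simp

text \<open>In terms of positions, between any two mutually inverse letters of a reduced word there is a
  letter that does not commute with them.\<close>

lemma reduced_no_cancelling_pair:
  "reduced w \<Longrightarrow> i < j \<Longrightarrow> j < length w \<Longrightarrow> w ! j = inv_letter (w ! i) \<Longrightarrow>
    \<exists>s. i < s \<and> s < j \<and> \<not> comm (fst (w ! i)) (fst (w ! s))"
proof (induction w arbitrary: i j)
  case (Cons x w)
  obtain j' where j: "j = Suc j'" using Cons.prems by (cases j) auto
  show ?case
  proof (cases i)
    case 0
    have "\<not> leads (inv_letter x) w" "w ! j' = inv_letter x" "j' < length w"
      using Cons.prems j 0 by auto
    then obtain s where "s < j'" "\<not> comm (fst x) (fst (w ! s))"
      by (auto simp: leads_nth)
    then show ?thesis using 0 j by (intro exI[of _ "Suc s"]) simp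
  next
    case (Suc i')
    have "\<exists>s. i' < s \<and> s < j' \<and> \<not> comm (fst (w ! i')) (fst (w ! s))"
      using Cons.prems j Suc by (intro Cons.IH) auto
    then obtain s where "i' < s \<and> s < j' \<and> \<not> comm (fst (w ! i')) (fst (w ! s))" by blast
    then show ?thesis using Suc j by (intro exI[of _ "Suc s"]) simp
  qed
qed simp

section \<open>Shortest words and powers\<close>

text \<open>The relators only say that the positive generators commute; the other three choices of
  signs follow by inverting one factor at a time.\<close>

lemma pres_eq_commute_letters:
  assumes "comm (fst x) (fst y)" "fst x \<in> X" "fst y \<in> X"
  shows "pres_eq X relators [x, y] [y, x]"
proof -
  let ?eq = "pres_eq X relators"
  obtain a e b d where xy: "x = (a, e)" "y = (b, d)" by fastforce
  let ?a = "[(a, True)]" and ?b = "[(b, True)]"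
  have ab: "comm a b" "a \<in> X" "b \<in> X" using assms xy by auto
  have "?eq ([] @ commutator_word a b @ (?b @ ?a)) ([] @ (?b @ ?a))"
    using ab by (intro pres_eq.relator) (auto simp: commutator_word_def)
  then have 1: "?eq ([(a, True), (b, True), (a, False)] @ [(b, False), (b, \<not> False)] @ ?a) (?b @ ?a)"
    by (simp add: commutator_word_def)
  have 2: "?eq ([(a, True), (b, True), (a, False)] @ [(b, False), (b, \<not> False)] @ ?a)
      ([(a, True), (b, True), (a, False)] @ ?a)"
    using ab by (intro pres_eq.cancel) auto
  have 3: "?eq ((?a @ ?b) @ [(a, False), (a, \<not> False)] @ []) ((?a @ ?b) @ [])"
    using ab by (intro pres_eq.cancel) auto
  have "?eq (?a @ ?b) (?b @ ?a)"
    using pres_eq.trans[OF pres_eq.sym[OF 3]] pres_eq.trans[OF pres_eq.sym[OF 2] 1] by simp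
  then have 4: "?eq ([(a, e)] @ ?b) (?b @ [(a, e)])"
    using pres_eq_commute_inv_word[of X relators ?a ?b] 
    by (cases e) (simp_all add: inv_letter_def)
  then have "?eq ([(b, d)] @ [(a, e)]) ([(a, e)] @ [(b, d)])"
    using pres_eq_commute_inv_word[of X relators ?b "[(a, e)]"] 
    by (cases d) (simp_all add: inv_letter_def pres_eq.sym)
  then show ?thesis by (simp add: xy pres_eq.sym)
qed

lemma pres_eq_commute_letter_word:
  "\<forall>y\<in>set p. comm (fst x) (fst y) \<Longrightarrow> x # p \<in> words X \<Longrightarrow>
    pres_eq X relators (x # p) (p @ [x])"
proof (induction p)
  case (Cons y p)
  have "pres_eq X relators ([x, y] @ p) ([y, x] @ p)"
    using Cons.prems
    by (intro pres_eq_append pres_eq_commute_letters pres_eq.refl) auto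
  moreover have "pres_eq X relators ([y] @ (x # p)) ([y] @ (p @ [x]))"
    using Cons by (intro pres_eq_append pres_eq.refl) auto
  ultimately show ?case by (auto intro: pres_eq.trans)
qed (auto intro: pres_eq.refl)

lemma pres_eq_leads:
  assumes "leads x w" "w \<in> words X"
  shows "pres_eq X relators w (x # remove1 x w)"
proof -
  obtain p q where pq: "w = p @ x # q" "remove1 x w = p @ q" "\<forall>y\<in>set p. comm (fst x) (fst y)"
    using remove1_leads[OF assms(1)] .
  have "pres_eq X relators ((x # p) @ q) ((p @ [x]) @ q)"
    using pq assms(2) by (intro pres_eq_append pres_eq_commute_letter_word pres_eq.refl) auto
  then show ?thesis unfolding pq(2) by (simp add: pq(1) pres_eq.sym)
qed

lemma pres_eq_ends:
  assumes "ends x w" "w \<in> words X"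
  shows "\<exists>v. pres_eq X relators w (v @ [x]) \<and> length w = Suc (length v)"
proof -
  obtain p q where pq: "w = p @ x # q" "\<forall>y\<in>set q. comm (fst x) (fst y)"
    using ends_split[OF assms(1)] by blast
  have "pres_eq X relators (p @ (x # q)) (p @ (q @ [x]))"
    using pq assms(2) by (intro pres_eq_append pres_eq_commute_letter_word pres_eq.refl) auto
  then show ?thesis using pq by (intro exI[of _ "p @ q"]) simp
qed

lemma not_reduced_imp_shorter:
  "\<not> reduced w \<Longrightarrow> w \<in> words X \<Longrightarrow> \<exists>v. pres_eq X relators w v \<and> length v < length w"
proof (induction w)
  case (Cons x w)
  show ?case
  proof (cases "reduced w")
    case True
    let ?x = "inv_letter x"
    have l: "leads ?x w" using Cons.prems True by simp
    have "pres_eq X relators ([x] @ w) ([x] @ (?x # remove1 ?x w))"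
      using Cons.prems l by (intro pres_eq_append pres_eq_leads pres_eq.refl) auto
    moreover have r: "remove1 ?x w \<in> words X"
      using pres_eq_words[OF pres_eq_leads[OF l]] Cons.prems by auto
    have "pres_eq X relators ([] @ [x, ?x] @ remove1 ?x w) ([] @ remove1 ?x w)"
      using Cons.prems r by (intro pres_eq_cancel_letters) auto
    ultimately have "pres_eq X relators (x # w) (remove1 ?x w)" by (auto intro: pres_eq.trans)
    moreover have "length (remove1 ?x w) < length (x # w)"
      by (simp add: less_Suc_eq_le length_remove1)
    ultimately show ?thesis by blast
  next
    case False
    then obtain v where v: "pres_eq X relators w v" "length v < length w" using Cons by auto
    have "pres_eq X relators ([x] @ w) ([x] @ v)"
      using Cons.prems v by (intro pres_eq_append pres_eq.refl) auto
    then show ?thesis using v by (intro exI[of _ "x # v"]) simp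
  qed
qed simp

text \<open>Trimmed words are those that cannot be shortened by conjugating with a letter, up to swaps of
  commuting letters.\<close>

definition trimmed :: "'a letter list \<Rightarrow> bool" where
  "trimmed w \<longleftrightarrow> (\<forall>x. \<not> (leads x w \<and> ends (inv_letter x) w))"

text \<open>The letters \<open>x\<close> and \<open>x\<inverse>\<close> do not commute, so the \<open>x\<close> that moves to the front stands to the left of
  the \<open>x\<inverse>\<close> that moves to the end, and both moves can be made at once.\<close>

lemma not_trimmed_imp_conjugate:
  assumes "\<not> trimmed w" "w \<in> words X"
  obtains x v where "pres_eq X relators w (x # v @ [inv_letter x])" "length w = length v + 2"
proof -
  obtain x where x: "leads x w" "ends (inv_letter x) w" using assms by (auto simp: trimmed_def)
  obtain p q where pq: "w = p @ x # q" "remove1 x w = p @ q" "\<forall>y\<in>set p. comm (fst x) (fst y)"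
    using remove1_leads[OF x(1)] .
  have w: "fst x \<in> X" "p \<in> words X" "q \<in> words X" using assms(2) pq by auto
  have "ends (inv_letter x) q"
    using x(2) pq by (auto simp: ends_append ends_Cons)
  then obtain v where v: "pres_eq X relators q (v @ [inv_letter x])" "length q = Suc (length v)"
    using pres_eq_ends w by blast
  have "pres_eq X relators w ((x # p) @ q)"
    using pres_eq_leads[OF x(1) assms(2)] pq by simp
  also have "pres_eq X relators \<dots> ((x # p) @ (v @ [inv_letter x]))"
    using v w by (intro pres_eq_append pres_eq.refl) auto
  finally show ?thesis using that[of x "p @ v"] v pq by simp
qed

text \<open>The length is kept, so that a shortest word for an element yields a shortest word of the
  shape \<open>y v y\<inverse>\<close>.\<close>

lemma exists_trimmed_conjugate:
  "w \<in> words X \<Longrightarrow> \<exists>y v. pres_eq X relators w (y @ v @ inv_word y) \<and> trimmed v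
     \<and> length (y @ v @ inv_word y) = length w"
proof (induction "length w" arbitrary: w rule: less_induct)
  case less
  show ?case
  proof (cases "trimmed w")
    case True
    then show ?thesis using less.prems by (intro exI[of _ "[]"] exI[of _ w]) (auto intro: pres_eq.refl)
  next
    case False
    obtain x w' where x: "pres_eq X relators w (x # w' @ [inv_letter x])" "length w = length w' + 2"
      using not_trimmed_imp_conjugate[OF False less.prems] .
    have w': "fst x \<in> X" "w' \<in> words X" using pres_eq_words[OF x(1)] by auto
    obtain y v where v: "pres_eq X relators w' (y @ v @ inv_word y)" "trimmed v" 
        "length (y @ v @ inv_word y) = length w'"
      using less.hyps[of w'] x(2) w' by auto
    have "pres_eq X relators ([x] @ w' @ [inv_letter x]) 
        ([x] @ (y @ v @ inv_word y) @ [inv_letter x])"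
      using v w' by (intro pres_eq_append pres_eq.refl) auto
    with x have "pres_eq X relators w ((x # y) @ v @ inv_word (x # y))"
      by (auto intro: pres_eq.trans)
    then show ?thesis using v x(2) by (intro exI[of _ "x # y"] exI[of _ v]) simp
  qed
qed

lemma ends_not_comm: "ends x w \<Longrightarrow> \<exists>y\<in>set w. \<not> comm (fst x) (fst y)"
  using leads_not_comm[of x "rev w"] by (simp add: ends_def)

text \<open>A cancellation between two copies of \<open>v\<close> involves two letters without a full copy of \<open>v\<close> between
  them, since such a copy would contain their generator. Hence it takes place at the
  junction of consecutive copies, and \<open>v\<close> would not be trimmed.\<close>

lemma trimmed_reduced_append:
  assumes "reduced (y @ v)" "trimmed v"
  shows "reduced (y @ word_power v (Suc n))"
proof (induction n)
  case 0
  then show ?case using assms by simp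
next
  case (Suc n)
  let ?u = "y @ word_power v (Suc n)"
  have "\<not> leads (inv_letter x) v" if "ends x ?u" for x
  proof
    assume l: "leads (inv_letter x) v"
    then obtain z where "z \<in> set v" "\<not> comm (fst x) (fst z)" using leads_not_comm by fastforce
    then have "ends x v"
      using that unfolding word_power_Suc_right append_assoc[symmetric] ends_append[of x _ v] 
      by blast
    with l assms(2) have "\<not> ends (inv_letter (inv_letter x)) v"
      unfolding trimmed_def by blast
    with \<open>ends x v\<close> show False by simp
  qed
  then have "reduced (?u @ v)"
    using Suc assms by (simp only: reduced_append[of ?u v]) (simp add: reduced_append)
  then show ?case by (simp add: word_power_Suc_right[of v "Suc n"] del: word_power_Suc)
qed

text \<open>A letter of \<open>z\<close> that cancels in \<open>y v\<^sup>n z\<close> either does so against the last copy of \<open>v\<close>, or it commutes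
  with \<open>v\<close> and cancels against \<open>y\<close>; both would already happen in \<open>y v z\<close>.\<close>

lemma reduced_word_power:
  assumes "reduced (y @ v @ z)" "trimmed v" "n > 0"
  shows "reduced (y @ word_power v n @ z)"
proof -
  obtain m where n: "n = Suc m" using assms(3) by (cases n) auto
  let ?u = "y @ word_power v n"
  have yvz: "reduced (y @ v)" "reduced z"
    "\<And>x. ends x (y @ v) \<Longrightarrow> \<not> leads (inv_letter x) z"
    using assms(1) reduced_append[of "y @ v" z] by auto
  have "reduced ?u" unfolding n by (rule trimmed_reduced_append[OF yvz(1) assms(2)])
  moreover have "\<not> leads (inv_letter x) z" if "ends x ?u" for x
  proof -
    have "set (word_power v n) = set v" unfolding n by (induction m) auto
    moreover have "ends x v \<or> (\<forall>z\<in>set v. comm (fst x) (fst z)) \<and> ends x (y @ word_power v m)"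
      using that unfolding n word_power_Suc_right append_assoc[symmetric] ends_append[of x _ v] .
    ultimately have "ends x (y @ v)"
      using that ends_not_comm[of x "word_power v n"] by (auto simp: ends_append)
    then show ?thesis using yvz by blast
  qed
  ultimately have "reduced (?u @ z)" using yvz by (simp only: reduced_append[of ?u z]) auto
  then show ?thesis by simp
qed

text \<open>Both \<open>w\<close> and \<open>y v\<^sup>n y\<inverse>\<close> are reduced words for the same element, where \<open>y v y\<inverse>\<close> is a shortest word
  for \<open>h\<close> with \<open>v\<close> trimmed. So they have the same length, and \<open>w\<close>, being no longer than the conjugate
  \<open>v\<^sup>n\<close>, leaves no room for \<open>y\<close>.\<close>

lemma minimal_word_of_power_is_periodic:
  assumes w: "w \<in> words X" and h: "h \<in> words X" and n: "n > 0"
    and eq: "pres_eq X relators w (word_power h n)"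
    and min: "\<And>y v. pres_eq X relators w (y @ v @ inv_word y) \<Longrightarrow> length w \<le> length v"
  shows "(\<exists>v. proj w = proj (word_power v n)) \<and> (\<forall>m. reduced (word_power w m))"
proof -
  have red: "reduced w"
    using not_reduced_imp_shorter[OF _ w] min[of "[]"] by (auto simp: not_le[symmetric])
  have "trimmed w"
  proof (rule ccontr)
    assume "\<not> trimmed w"
    then obtain x v where "pres_eq X relators w (x # v @ [inv_letter x])" "length w = length v + 2"
      using not_trimmed_imp_conjugate w by blast
    then show False using min[of "[x]" v] by simp
  qed
  then have powers: "reduced (word_power w m)" for m
    using reduced_word_power[of "[]" w "[]" m] red by (cases "m = 0") auto
  obtain r where r: "pres_eq X relators h r"
    and r_min: "\<And>r'. pres_eq X relators h r' \<Longrightarrow> length r \<le> length r'"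
    using ex_has_least_nat[of "pres_eq X relators h" h length] pres_eq.refl[OF h] by blast
  have "r \<in> words X" using pres_eq_words[OF r] by simp
  then obtain y v where yv: "pres_eq X relators r (y @ v @ inv_word y)" "trimmed v"
      "length (y @ v @ inv_word y) = length r"
    using exists_trimmed_conjugate by blast
  have hyv: "pres_eq X relators h (y @ v @ inv_word y)" using r yv(1) by (rule pres_eq.trans)
  then have words: "y \<in> words X" "v \<in> words X" using pres_eq_words[OF hyv] by auto
  have "reduced (y @ v @ inv_word y)"
  proof (rule ccontr)
    assume "\<not> reduced (y @ v @ inv_word y)"
    then obtain r' where "pres_eq X relators (y @ v @ inv_word y) r'"
        "length r' < length (y @ v @ inv_word y)"
      using not_reduced_imp_shorter pres_eq_words[OF hyv] by blast
    then show False using r_min[of r'] yv(3) pres_eq.trans[OF hyv] by fastforce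
  qed
  then have red': "reduced (y @ word_power v n @ inv_word y)"
    using reduced_word_power yv(2) n by blast
  have w_eq: "pres_eq X relators w (y @ word_power v n @ inv_word y)"
    using eq pres_eq_word_power[OF hyv, of n] pres_eq_conj_power[OF words, of relators n]
    by (blast intro: pres_eq.trans)
  have proj: "proj w = proj (y @ word_power v n @ inv_word y)"
    using reduced_pres_eq_imp_proj_eq[OF w_eq red red'] .
  then have "length w = length (y @ word_power v n @ inv_word y)"
    using proj_eq_imp_matching by blast
  moreover have "length w \<le> length (word_power v n)" using min[OF w_eq] .
  ultimately have "y = []" by simp
  then have "proj w = proj (word_power v n)" using proj by simp
  with powers show ?thesis by blast
qed

section \<open>Mirrored intervals in a periodic word\<close>

text \<open>The interval \<open>{p..<q}\<close> is the place of a word in the reduced bi-infinite word \<open>W\<close>, its mirror image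
  under \<open>i \<mapsto> C - i\<close> is the place of the inverse word, and \<open>\<sigma>\<close> is a symmetry of \<open>W\<close> up to swaps of
  commuting letters. The composition \<open>\<psi>\<close> of the reflection with \<open>\<sigma>\<close> inverts letters and
  reverses the order of any two positions of the interval whose letters do not commute. A position
  of the interval that \<open>\<psi>\<close> maps into the interval would be exchanged with its image, and an exchanged
  pair always encloses a closer one.\<close>

lemma shift_mirror_disjoint:
  fixes W :: "int \<Rightarrow> 'a letter" and \<sigma> :: "int \<Rightarrow> int"
  assumes bij: "bij \<sigma>" and W\<sigma>: "\<And>i. W (\<sigma> i) = W i"
    and mono: "\<And>i j. i < j \<Longrightarrow> \<not> comm (fst (W i)) (fst (W j)) \<Longrightarrow> \<sigma> i < \<sigma> j"
    and red: "\<And>i j. i < j \<Longrightarrow> W j = inv_letter (W i) \<Longrightarrow>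
      \<exists>s. i < s \<and> s < j \<and> \<not> comm (fst (W i)) (fst (W s))"
    and mirror: "\<And>i. i \<in> {p..<q} \<Longrightarrow> W (C - i) = inv_letter (W i)"
    and z: "z \<in> {p..<q}"
  shows "\<sigma> (C - z) \<notin> {p..<q}"
proof
  define \<psi> where "\<psi> i = \<sigma> (C - i)" for i
  let ?U = "{p..<q}" and ?D = "\<lambda>i j. \<not> comm (fst (W i)) (fst (W j))"
  assume "\<sigma> (C - z) \<in> {p..<q}"
  then have \<psi>z: "\<psi> z \<in> ?U" by (simp add: \<psi>_def)
  have W\<psi>: "W (\<psi> i) = inv_letter (W i)" if "i \<in> ?U" for i
    using that by (simp add: \<psi>_def W\<sigma> mirror)
  have \<psi>_neq: "\<psi> i \<noteq> i" if "i \<in> ?U" for i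
    using W\<psi>[OF that] by auto
  have mono_iff: "\<sigma> i < \<sigma> j \<longleftrightarrow> i < j" if "?D i j" for i j
  proof -
    have "?D j i" using that comm_sym by blast
    then show ?thesis using that mono[of i j] mono[of j i] by (cases i j rule: linorder_cases) auto
  qed
  have anti: "\<psi> j < \<psi> i" if "i < j" "i \<in> ?U" "j \<in> ?U" "?D i j" for i j
  proof -
    have "?D (C - j) (C - i)" using that by (simp add: mirror) (use comm_sym in blast)
    then show ?thesis using that by (simp add: \<psi>_def mono_iff)
  qed
  have inj\<psi>: "inj \<psi>" by (intro injI) (simp add: \<psi>_def inj_eq[OF bij_is_inj[OF bij]])
  \<comment> \<open>On the occurrences of one generator \<open>\<psi>\<close> reverses the order and leaves no gaps.\<close>
  have img: "\<psi> ` {s \<in> {i..j}. fst (W s) = a} = {s \<in> {\<psi> j..\<psi> i}. fst (W s) = a}"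
    if ij: "i \<in> ?U" "j \<in> ?U" "fst (W i) = a" "fst (W j) = a" for i j a
  proof (intro equalityI subsetI)
    fix t assume "t \<in> \<psi> ` {s \<in> {i..j}. fst (W s) = a}"
    then obtain s where s: "t = \<psi> s" "s \<in> {i..j}" "fst (W s) = a" by blast
    have sU: "s \<in> ?U" using s ij by auto
    have "\<psi> s \<le> \<psi> i" using anti[of i s] s ij sU by (cases "i = s") auto
    moreover have "\<psi> j \<le> \<psi> s" using anti[of s j] s ij sU by (cases "j = s") auto
    ultimately show "t \<in> {s \<in> {\<psi> j..\<psi> i}. fst (W s) = a}"
      using s W\<psi>[OF sU] by simp
  next
    fix t assume t: "t \<in> {s \<in> {\<psi> j..\<psi> i}. fst (W s) = a}"
    obtain r where r: "t = \<sigma> r" using bij by (metis bij_pointE)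
    have ra: "fst (W r) = a" using t r by (simp add: W\<sigma>)
    have "C - j \<le> r" "r \<le> C - i"
      using t r ra ij mono_iff[of r "C - j"] mono_iff[of "C - i" r]
      by (auto simp: \<psi>_def mirror not_less[symmetric])
    then have s: "C - r \<in> {i..j}" by auto
    then have "C - r \<in> ?U" using ij by auto
    then have "fst (W (C - r)) = a" using mirror[of "C - r"] ra by simp
    then show "t \<in> \<psi> ` {s \<in> {i..j}. fst (W s) = a}"
      using s r by (intro image_eqI[of _ _ "C - r"]) (auto simp: \<psi>_def)
  qed
  have card_eq: "card {s \<in> {\<psi> j..\<psi> i}. fst (W s) = a} = card {s \<in> {i..j}. fst (W s) = a}"
    if "i \<in> ?U" "j \<in> ?U" "fst (W i) = a" "fst (W j) = a" for i j a
    unfolding img[OF that, symmetric] by (rule card_image) (rule inj_on_subset[OF inj\<psi>], simp)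
  \<comment> \<open>The segments from \<open>\<psi> i\<close> to \<open>i\<close> and from \<open>\<psi> i\<close> to \<open>\<psi> (\<psi> i)\<close> lie on the same side of
    \<open>\<psi> i\<close> and contain equally many occurrences of the generator at \<open>i\<close>, so they coincide.\<close>
  have invol: "\<psi> (\<psi> i) = i" if i: "i \<in> ?U" "\<psi> i \<in> ?U" for i
  proof -
    let ?a = "fst (W i)"
    let ?N = "\<lambda>x y. {s \<in> {x..y}. fst (W s) = ?a}"
    have fin: "finite (?N x y)" for x y by (rule finite_subset[of _ "{x..y}"]) auto
    have lab: "fst (W (\<psi> i)) = ?a" "fst (W (\<psi> (\<psi> i))) = ?a" using W\<psi> i by simp_all
    have less: "card B < card A" if "finite A" "B \<subseteq> A" "x \<in> A" "x \<notin> B" for A B :: "int set" and x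
      using that by (intro psubset_card_mono) auto
    have lessl: "card (?N y t) < card (?N x t)" if "x < y" "x \<le> t" "fst (W x) = ?a" for x y t
      using that by (intro less[of _ _ x] fin) auto
    have lessu: "card (?N t x) < card (?N t y)" if "x < y" "t \<le> y" "fst (W y) = ?a" for x y t
      using that by (intro less[of _ _ y] fin) auto
    have lower: "x = y" if "card (?N x t) = card (?N y t)" "x \<le> t" "fst (W x) = ?a" 
      "y \<le> t" "fst (W y) = ?a" for x y t
      using lessl[of x y t] lessl[of y x t] that by (cases x y rule: linorder_cases) auto
    have upper: "x = y" if "card (?N t x) = card (?N t y)" "t \<le> x" "fst (W x) = ?a" 
      "t \<le> y" "fst (W y) = ?a" for x y t
      using lessu[of x y t] lessu[of y x t] that by (cases x y rule: linorder_cases) auto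
    show ?thesis
    proof (cases "i < \<psi> i")
      case True
      have "\<psi> (\<psi> i) < \<psi> i" using anti[of i "\<psi> i"] True i lab by simp
      then show ?thesis using card_eq[of i "\<psi> i" ?a] lower[of "\<psi> (\<psi> i)" "\<psi> i" i] i lab True by simp
    next
      case False
      then have lt: "\<psi> i < i" using \<psi>_neq[OF i(1)] by simp
      have "\<psi> i < \<psi> (\<psi> i)" using anti[of "\<psi> i" i] lt i lab by simp
      then show ?thesis using card_eq[of "\<psi> i" i ?a] upper[of "\<psi> i" "\<psi> (\<psi> i)" i] i lab lt by simp
    qed
  qed
  \<comment> \<open>Descent on the distance: a letter at \<open>s\<close> that separates an exchanged pair is itself
    exchanged with a position strictly between the two.\<close>
  have no_swap: False if "i < j" "i \<in> ?U" "j \<in> ?U" "\<psi> i = j" "\<psi> j = i" for i j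
    using that
  proof (induction "nat (j - i)" arbitrary: i j rule: less_induct)
    case less
    have "W j = inv_letter (W i)" using W\<psi>[of i] less.prems by simp
    from red[OF less.prems(1) this] obtain s 
      where s: "i < s" "s < j" "?D i s" by blast
    have sU: "s \<in> ?U" using s less.prems by auto
    have "?D s j" using s comm_sym W\<psi>[of i] less.prems by auto
    then have \<psi>s: "i < \<psi> s" "\<psi> s < j"
      using anti[of i s] anti[of s j] s sU less.prems by auto
    then have \<psi>sU: "\<psi> s \<in> ?U" using less.prems by auto
    show False
    proof (cases "s < \<psi> s")
      case True
      then show False using less.hyps[of "\<psi> s" s] s \<psi>s sU \<psi>sU invol[OF sU \<psi>sU] by auto
    next
      case False
      then have "\<psi> s < s" using \<psi>_neq[OF sU] by simp
      then show False using less.hyps[of s "\<psi> s"] s \<psi>s sU \<psi>sU invol[OF sU \<psi>sU] by auto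
    qed
  qed
  show False
    using no_swap[of z "\<psi> z"] no_swap[of "\<psi> z" z] z \<psi>z invol[OF z \<psi>z] \<psi>_neq[OF z]
    by (cases "z < \<psi> z") auto
qed

text \<open>Two positions of \<open>W\<close> are equivalent if their images under \<open>\<theta>\<close> differ by a multiple of \<open>\<tau>\<close>, and
  \<open>\<kappa>\<close> names the class of a position by a residue modulo \<open>\<tau>\<close>. The interval and its mirror image
  take up \<open>2 * (q - p)\<close> different ones of the \<open>\<tau>\<close> classes.\<close>

lemma mirror_length_le_half_period:
  fixes W V :: "int \<Rightarrow> 'a letter" and \<theta> :: "int \<Rightarrow> int"
  assumes bij: "bij \<theta>" and V\<theta>: "\<And>i. V (\<theta> i) = W i"
    and mono: "\<And>i j. i < j \<Longrightarrow> \<not> comm (fst (W i)) (fst (W j)) \<Longrightarrow> \<theta> i < \<theta> j"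
    and \<tau>: "\<tau> > 0" and period: "\<And>i j. i mod \<tau> = j mod \<tau> \<Longrightarrow> V i = V j"
    and red: "\<And>i j. i < j \<Longrightarrow> W j = inv_letter (W i) \<Longrightarrow>
      \<exists>s. i < s \<and> s < j \<and> \<not> comm (fst (W i)) (fst (W s))"
    and mirror: "\<And>i. i \<in> {p..<q} \<Longrightarrow> W (C - i) = inv_letter (W i)"
  shows "2 * (q - p) \<le> \<tau>"
proof (cases "p < q")
  case True
  let ?U = "{p..<q}" and ?U' = "{C - q + 1..<C - p + 1}"
  define \<kappa> where "\<kappa> i = \<theta> i mod \<tau>" for i
  define \<eta> where "\<eta> = inv_into UNIV \<theta>"
  have inv\<theta>: "\<theta> (\<eta> i) = i" for i 
    unfolding \<eta>_def using bij by (simp add: bij_is_surj surj_f_inv_f)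
  have bij\<eta>: "bij \<eta>" unfolding \<eta>_def by (rule bij_imp_bij_inv[OF bij])
  have mono_iff: "\<theta> i < \<theta> j \<longleftrightarrow> i < j" if "\<not> comm (fst (W i)) (fst (W j))" for i j
  proof -
    have "\<not> comm (fst (W j)) (fst (W i))" using that comm_sym by blast
    then show ?thesis using that mono[of i j] mono[of j i] by (cases i j rule: linorder_cases) auto
  qed
  have W\<kappa>: "W i = W j" if "\<kappa> i = \<kappa> j" for i j
    using period[of "\<theta> i" "\<theta> j"] that by (simp add: \<kappa>_def V\<theta>)
  have disj: "\<kappa> x \<noteq> \<kappa> (C - y)" if xy: "x \<in> ?U" "y \<in> ?U" for x y
  proof
    assume eq: "\<kappa> x = \<kappa> (C - y)"
    define d where "d = \<theta> x - \<theta> (C - y)"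
    \<comment> \<open>The translation of \<open>V\<close> by \<open>d\<close>, transported to \<open>W\<close>.\<close>
    define \<sigma> where "\<sigma> i = \<eta> (\<theta> i + d)" for i
    have \<theta>\<sigma>: "\<theta> (\<sigma> i) = \<theta> i + d" for i by (simp add: \<sigma>_def inv\<theta>)
    have "d mod \<tau> = 0" using eq unfolding d_def \<kappa>_def by (simp add: mod_eq_dvd_iff)
    then have W\<sigma>: "W (\<sigma> i) = W i" for i by (intro W\<kappa>) (simp add: \<kappa>_def \<theta>\<sigma> mod_add_eq[of _ \<tau> d, symmetric])
    have "bij \<sigma>"
      unfolding \<sigma>_def
      by (rule bij_betw_trans[OF bij_betw_trans[OF bij, of "\<lambda>i. i + d" UNIV] bij\<eta>, 
           unfolded comp_def]) (simp add: bij_plus_right)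
    moreover have "\<sigma> i < \<sigma> j" if "i < j" "\<not> comm (fst (W i)) (fst (W j))" for i j
      using mono_iff[of "\<sigma> i" "\<sigma> j"] mono[OF that] that by (simp add: W\<sigma> \<theta>\<sigma>)
    ultimately have "\<sigma> (C - y) \<notin> ?U"
      by (rule shift_mirror_disjoint[OF _ W\<sigma> _ red mirror xy(2)])
    moreover have "\<sigma> (C - y) = x" 
      by (simp add: \<sigma>_def d_def \<eta>_def bij bij_is_inj)
    ultimately show False using xy by simp
  qed
  \<comment> \<open>An interval with two equivalent positions contains, between them, a position from each class
    of the same generator.\<close>
  have full: "\<exists>c'\<in>{r..<t}. \<kappa> c' = \<kappa> c"
    if "i \<in> {r..<t}" "j \<in> {r..<t}" "i < j" "\<kappa> i = \<kappa> j" "fst (W i) = fst (W c)" for i j c r t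
  proof -
    \<comment> \<open>The representative of the class of \<open>c\<close> whose image under \<open>\<theta>\<close> lies in the period that starts at
      \<open>\<theta> i\<close>.\<close>
    define c' where "c' = \<eta> (\<theta> i + (\<theta> c - \<theta> i) mod \<tau>)"
    have \<theta>c': "\<theta> c' = \<theta> i + (\<theta> c - \<theta> i) mod \<tau>" by (simp add: c'_def inv\<theta>)
    have \<kappa>c': "\<kappa> c' = \<kappa> c" by (simp add: \<kappa>_def \<theta>c' mod_add_right_eq)
    have lab: "fst (W c') = fst (W i)" "fst (W j) = fst (W i)"
      using W\<kappa>[OF \<kappa>c'] W\<kappa>[OF that(4)] that(5) by simp_all
    have "\<theta> i < \<theta> j" using mono[of i j] that lab by simp
    moreover have "\<tau> dvd \<theta> j - \<theta> i" using that(4) by (metis \<kappa>_def mod_eq_dvd_iff)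
    ultimately have "\<tau> \<le> \<theta> j - \<theta> i" by (simp add: zdvd_imp_le)
    moreover have "0 \<le> (\<theta> c - \<theta> i) mod \<tau>" "(\<theta> c - \<theta> i) mod \<tau> < \<tau>" using \<tau> by simp_all
    ultimately have "\<theta> i \<le> \<theta> c'" "\<theta> c' < \<theta> j" by (simp_all add: \<theta>c')
    then have "i \<le> c'" "c' < j" 
      using mono_iff[of c' i] mono_iff[of c' j] lab by auto
    then show ?thesis using \<kappa>c' that by (intro bexI[of _ c']) auto
  qed
  have U': "x \<in> ?U' \<longleftrightarrow> C - x \<in> ?U" for x by auto
  have injU: "inj_on \<kappa> ?U"
  proof (rule linorder_inj_onI', rule notI)
    fix i j assume ij: "i \<in> ?U" "j \<in> ?U" "i < j" "\<kappa> i = \<kappa> j"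
    obtain c' where "c' \<in> ?U" "\<kappa> c' = \<kappa> (C - i)"
      using full[OF ij(1-4), of "C - i"] mirror[OF ij(1)] by auto
    then show False using disj[of c' i] ij by simp
  qed
  have injU': "inj_on \<kappa> ?U'"
  proof (rule linorder_inj_onI', rule notI)
    fix i j assume ij: "i \<in> ?U'" "j \<in> ?U'" "i < j" "\<kappa> i = \<kappa> j"
    have i: "C - i \<in> ?U" using ij U' by blast
    obtain c' where c': "c' \<in> ?U'" "\<kappa> c' = \<kappa> (C - i)"
      using full[OF ij(1-4), of "C - i"] mirror[OF i] by auto
    then have "C - c' \<in> ?U" using U' by blast
    then show False using disj[of "C - i" "C - c'"] c' i by simp
  qed
  have "\<kappa> ` ?U \<inter> \<kappa> ` ?U' = {}"
  proof -
    have False if "x \<in> ?U" "y \<in> ?U'" "\<kappa> x = \<kappa> y" for x y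
      using disj[of x "C - y"] that U'[of y] by simp
    then show ?thesis by blast
  qed
  then have "card (\<kappa> ` ?U) + card (\<kappa> ` ?U') = card (\<kappa> ` ?U \<union> \<kappa> ` ?U')"
    by (simp add: card_Un_disjoint)
  also have "\<dots> \<le> card {0..<\<tau>}"
    using \<tau> by (intro card_mono) (auto simp: \<kappa>_def)
  finally show ?thesis
    using True by (simp add: card_image[OF injU] card_image[OF injU'])
qed (use \<tau> in simp)

text \<open>The matching of \<open>w\<close> with \<open>v\<^sup>n\<close> extends block by block to the bi-infinite words, because letters from
  different blocks keep their order.\<close>

lemma length_inverse_pair_le:
  assumes proj: "proj w = proj (word_power v n)"
    and red: "\<And>m. reduced (word_power w m)"
    and u: "cyclic_subword u w" "cyclic_subword (inv_word u) w"
  shows "2 * length u \<le> length v"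
proof (cases "w = []")
  case True
  then show ?thesis using u(1) by (auto simp: cyclic_subword_def)
next
  case False
  define L where "L = int (length w)"
  define \<tau> where "\<tau> = int (length v)"
  obtain \<theta> where len: "length w = length (word_power v n)"
    and \<theta>bij: "bij_betw \<theta> {..<length w} {..<length (word_power v n)}"
    and \<theta>eq: "\<And>i. i < length w \<Longrightarrow> word_power v n ! \<theta> i = w ! i"
    and \<theta>mono: "\<And>i j. \<lbrakk>i < j; j < length w; \<not> comm (fst (w ! i)) (fst (w ! j))\<rbrakk> \<Longrightarrow> \<theta> i < \<theta> j"
    using proj_eq_imp_matching[OF proj] by blast
  have L\<tau>: "L = int n * \<tau>" using len by (simp add: L_def \<tau>_def)
  have L: "L > 0" "nat L = length w" using False by (simp_all add: L_def)
  have \<tau>: "\<tau> > 0" using L L\<tau> by (cases "\<tau> = 0") (auto simp: \<tau>_def)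
  have \<theta>bij': "bij_betw \<theta> {..<nat L} {..<nat L}" using \<theta>bij len L by simp
  then have sub: "\<theta> ` {..<nat L} \<subseteq> {..<nat L}" by (simp add: bij_betw_def)
  define W where "W i = w ! nat (i mod L)" for i
  define V where "V i = v ! nat (i mod \<tau>)" for i
  let ?\<theta> = "periodic_extension L \<theta>"
  note div_mod = periodic_extension_div_mod[OF L(1) sub]
  have mod_less: "nat (i mod L) < length w" for i
    using pos_mod_bound[OF L(1), of i] L(1) by (simp add: nat_less_iff flip: L_def)
  have V\<theta>: "V (?\<theta> i) = W i" for i
  proof -
    have less: "\<theta> (nat (i mod L)) < n * length v"
      using sub mod_less[of i] len L by (simp add: image_subset_iff)
    have "?\<theta> i mod \<tau> = ?\<theta> i mod L mod \<tau>" by (simp add: L\<tau> mod_mod_cancel)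
    also have "\<dots> = int (\<theta> (nat (i mod L)) mod length v)"
      by (simp add: div_mod \<tau>_def zmod_int)
    finally have "V (?\<theta> i) = v ! (\<theta> (nat (i mod L)) mod length v)" by (simp add: V_def)
    also have "\<dots> = W i"
      using \<theta>eq[OF mod_less[of i]] nth_word_power[OF less] by (simp add: W_def)
    finally show ?thesis .
  qed
  have mono: "?\<theta> i < ?\<theta> j" if ij: "i < j" "\<not> comm (fst (W i)) (fst (W j))" for i j
  proof (cases "i div L = j div L")
    case True
    then have "i mod L < j mod L"
      using ij(1) mult_div_mod_eq[of L i, unfolded True] mult_div_mod_eq[of L j] by linarith
    then have "nat (i mod L) < nat (j mod L)" using L by (subst nat_less_eq_zless) simp_all
    then have "\<theta> (nat (i mod L)) < \<theta> (nat (j mod L))"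
      using \<theta>mono[OF _ mod_less[of j]] ij(2) by (simp add: W_def)
    then show ?thesis using True by (simp add: periodic_extension_def)
  next
    case False
    then have "i div L < j div L" using zdiv_mono1[of i j L] ij(1) L by simp
    then have "?\<theta> i div L < ?\<theta> j div L" by (simp add: div_mod)
    then show ?thesis using zdiv_mono1[of "?\<theta> j" "?\<theta> i" L] L by linarith
  qed
  have period: "V i = V j" if "i mod \<tau> = j mod \<tau>" for i j using that by (simp add: V_def)
  have red': "\<exists>s. i < s \<and> s < j \<and> \<not> comm (fst (W i)) (fst (W s))"
    if ij: "i < j" "W j = inv_letter (W i)" for i j
  proof -
    \<comment> \<open>A pair of positions is moved into a power of \<open>w\<close>, starting in its first copy.\<close>
    define b where "b = i div L * L"
    have b: "W (b + int s) = w ! (s mod length w)" for s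
      by (simp add: W_def b_def) (simp add: L_def nat_mod_distrib)
    have b_le: "b \<le> i" 
      using div_mult_mod_eq[of i L] pos_mod_sign[OF L(1), of i] unfolding b_def by linarith
    define i' j' where "i' = nat (i - b)" and "j' = nat (j - b)"
    have i'j': "i = b + int i'" "j = b + int j'" "i' < j'"
      using ij(1) b_le by (auto simp: i'_def j'_def)
    let ?m = "Suc j'"
    have j'm: "j' < ?m * length w"
      using mult_le_mono2[of 1 "length w" "Suc j'"] False by (simp add: Suc_le_eq)
    have nth: "word_power w ?m ! s = W (b + int s)" if "s \<le> j'" for s
      using that j'm by (subst nth_word_power) (auto simp: b simp del: mult_Suc)
    have "\<exists>s. i' < s \<and> s < j' \<and> \<not> comm (fst (word_power w ?m ! i')) (fst (word_power w ?m ! s))"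
      using ij(2) i'j' j'm 
      by (intro reduced_no_cancelling_pair red) (simp_all add: nth del: word_power_Suc mult_Suc)
    then obtain s where "i' < s" "s < j'" "\<not> comm (fst (W i)) (fst (W (b + int s)))"
      using i'j' by (auto simp: nth simp del: word_power_Suc)
    then show ?thesis using i'j' by (intro exI[of _ "b + int s"]) auto
  qed
  obtain p where p: "\<And>t. t < length u \<Longrightarrow> u ! t = w ! ((p + t) mod length w)"
    using cyclic_subword_imp_nth[OF u(1)] by blast
  obtain q where q: "\<And>t. t < length u \<Longrightarrow> inv_word u ! t = w ! ((q + t) mod length w)"
    using cyclic_subword_imp_nth[OF u(2)] by (metis length_inv_word)
  have W_int: "W (int s) = w ! (s mod length w)" for s
    by (simp add: W_def L_def nat_mod_distrib)
  \<comment> \<open>If \<open>u\<close> occurs at \<open>p\<close> and its inverse at \<open>q\<close>, then the position \<open>p + t\<close> is reflected to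
    \<open>q + (length u - 1 - t)\<close>.\<close>
  let ?C = "int (p + q + length u) - 1"
  have mirror: "W (?C - i) = inv_letter (W i)" if i: "i \<in> {int p..<int (p + length u)}" for i
  proof -
    define t where "t = nat i - p"
    have t: "i = int (p + t)" "t < length u" using i by (auto simp: t_def)
    then have C: "?C - i = int (q + (length u - Suc t))" by auto
    have "W (?C - i) = inv_word u ! (length u - Suc t)"
      unfolding C W_int using t q[of "length u - Suc t"] by simp
    also have "\<dots> = inv_letter (u ! t)" using t by (simp add: nth_inv_word Suc_diff_Suc)
    also have "u ! t = W i" unfolding t(1) W_int using p t by simp
    finally show ?thesis .
  qed
  have "2 * (int (p + length u) - int p) \<le> \<tau>"
    by (rule mirror_length_le_half_period[OF bij_periodic_extension[OF L(1) \<theta>bij']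
          V\<theta> mono \<tau> period red' mirror])
  then show ?thesis by (simp add: \<tau>_def)
qed

end

section \<open>Inverse subwords of a power in a right-angled Artin group\<close>

theorem theorem6p6:
  fixes \<Gamma> :: "'a pair_pre_digraph"
    and g :: "'a letter list set"
    and n :: nat
    and w u :: "'a letter list"
  assumes "pair_graph \<Gamma>"
    and "g \<in> carrier (raag \<Gamma>)"
    and "n > 0"
    and "cyclically_reduced \<Gamma> w"
    and "raag_elem \<Gamma> w \<in> conjugacy_class (raag \<Gamma>) (g [^]\<^bsub>raag \<Gamma>\<^esub> n)"
    and "u \<in> words (pverts \<Gamma>)"
    and "cyclic_subword u w"
    and "cyclic_subword (inv_word u) w"
  shows "real (length u) \<le> real (length w) / (2 * real n)"
proof -
  let ?comm = "\<lambda>a b. (a, b) \<in> parcs \<Gamma>" and ?X = "pverts \<Gamma>"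
  interpret pair_graph \<Gamma> by (rule assms(1))
  interpret C: partial_commutation ?comm
    by unfold_locales (use arcs_symmetric no_loops' in blast)+
  have rel: "raag_relators \<Gamma> = C.relators" by (simp add: raag_relators_def)
  have w: "w \<in> words ?X" using assms(4) by (simp add: cyclically_reduced_def)
  obtain h where h: "h \<in> words ?X" "g = pres_rel ?X C.relators `` {h}"
    using assms(2) by (auto simp: raag_def rel carrier_presented_group)
  obtain y where y: "y \<in> words ?X"
      and eq: "pres_eq ?X C.relators w (y @ word_power h n @ inv_word y)"
    using assms(5) h w
    by (auto simp: raag_elem_def raag_def rel pow_presented_group conjugacy_class_presented_group
        words_word_power)
  \<comment> \<open>The conjugating element is absorbed into the root of the power.\<close>
  have eq': "pres_eq ?X C.relators w (word_power (y @ h @ inv_word y) n)"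
    using eq pres_eq.sym[OF pres_eq_conj_power[OF y h(1)]] by (rule pres_eq.trans)
  have yhy: "y @ h @ inv_word y \<in> words ?X" using y h(1) by simp
  have min: "length w \<le> length v" if "pres_eq ?X C.relators w (z @ v @ inv_word z)" for z v
  proof -
    have v: "z \<in> words ?X" "v \<in> words ?X" using pres_eq_words[OF that] by auto
    have "raag_elem \<Gamma> v \<in> conjugacy_class (raag \<Gamma>) (raag_elem \<Gamma> w)"
      using conjugacy_class_presented_group[OF w v(2), of C.relators] pres_eq_conj_swap[OF that] v(1)
      by (auto simp: raag_elem_def raag_def rel intro!: bexI[of _ "inv_word z"])
    then show ?thesis using assms(4) v(2) by (simp add: cyclically_reduced_def)
  qed
  obtain v where v: "C.proj w = C.proj (word_power v n)" and red: "\<And>m. C.reduced (word_power w m)"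
    using C.minimal_word_of_power_is_periodic[OF w yhy assms(3) eq'] min by blast
  have "length w = n * length v" using C.proj_eq_imp_matching[OF v] by simp
  moreover have "2 * length u \<le> length v"
    using C.length_inverse_pair_le[OF v red assms(7,8)] .
  ultimately have "2 * n * length u \<le> length w" by (simp add: mult.assoc mult.left_commute)
  then have "real (2 * n * length u) \<le> real (length w)" by (rule of_nat_mono)
  then show ?thesis using assms(3) by (simp add: field_simps)
qed

end
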